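(* Let $m>0$, let $f_d$ and $f_s$ be the (positive) dynamic and static friction coefficients, with $f_d\le f_s$, let $b:\mathbb{R}\times[0,\infty)\to\mathbb{R}$ be locally Lipschitz with at most linear growth, and let $x_0\in\mathbb{R}$ satisfy $|b(x_0,0)|\le f_s$. Let $x$ be the trajectory of the two-phase dry friction model started from $x(0)=x_0$, $\dot x(0)=0$, with entrance times in static phase $\tau_j$ (with corresponding states $x_j = x(\tau_j)$) and entrance times in dynamic phase $\tau_{j+\frac12}$, as defined in the context. Let $j\ge 0$ be such that $\tau_j$ and $\tau_{j+\frac12}$ are defined and finite. Then the entrance time in dynamic phase $\tau_{j+\frac12}$ is separated from its consecutive entrance time in static phase $\tau_{j+1}\in(0,\infty]$, i.e. $$\tau_{j+\frac12}<\tau_{j+1}.$$ Moreover, on the interval $(\tau_{j+\frac12},\tau_{j+1})$ one has $\operatorname{sign}(\dot x(t))\neq 0$ for almost every $t$, and the trajectory $x$ is the solution of $$ \begin{cases} m\ddot x(t)+\operatorname{sign}(\dot x(t))\,f_d=b(x(t),t)\quad\text{for a.e. } t\in(\tau_{j+\frac12},\tau_{j+1}),\\ x(\tau_{j+\frac12})=x_j,\quad \dot x(\tau_{j+\frac12})=0. \end{cases} $$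
   Context: Here $m$ is the mass, $f_d$ and $f_s$ are the dynamic and static friction coefficients, $b(x,t)$ collects the forces not related to dry friction, and $\operatorname{sign}(v)=1$ if $v>0$, $-1$ if $v<0$, $0$ if $v=0$. Infima of empty sets are $+\infty$. Variational inequality (V.I.). Given $s\ge 0$ and $\xi\in\mathbb{R}$, the V.I. started at $(s,\xi)$ is the problem of finding a $C^1$ function $y:[s,\infty)\to\mathbb{R}$, with $\ddot y$ locally bounded (i.e. $\dot y$ locally Lipschitz), such that $y(s)=\xi$, $\dot y(s)=0$ and, for a.e. $t>s$, $$\forall \varphi\in\mathbb{R},\quad (b(y(t),t)-m\ddot y(t))(\varphi-\dot y(t))+f_d|\dot y(t)|\le f_d|\varphi|.$$ It is a standard known fact that this problem has one and only one solution. Two-phase model. The trajectory $x$, the times $\tau_j,\tau_{j+\frac12}$ and the states $x_j$ are defined inductively. Start with $\tau_0=0$, $x(0)=x_0$, $\dot x(0)=0$, where $|b(x_0,0)|\le f_s$. Given a finite $\tau_j$ and $x_j=x(\tau_j)$ with $\dot x(\tau_j)=0$ and $|b(x_j,\tau_j)|\le f_s$: (Static phase) Define $\tau_{j+\frac12}=\inf\{t\ge\tau_j:\ |b(x_j,t)|>f_s\}$ and set $x(t)=x_j$, $\dot x(t)=0$ on $[\tau_j,\tau_{j+\frac12})$ (this interval may be empty). If $\tau_{j+\frac12}=\infty$, the trajectory stays in a static phase forever and the construction stops. (Dynamic phase) If $\tau_{j+\frac12}<\infty$, let $x$ on $[\tau_{j+\frac12},\infty)$ be (provisionally) the unique solution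 of the V.I. started at $(\tau_{j+\frac12},x_j)$, so $x(\tau_{j+\frac12})=x_j$, $\dot x(\tau_{j+\frac12})=0$, and define $$\tau_{j+1}=\inf\{t>\tau_{j+\frac12}:\ \dot x(t)=0\ \text{and}\ |b(x(t),t)|\le f_s\}.$$ The trajectory of the model is this V.I. solution on $[\tau_{j+\frac12},\tau_{j+1}]$ (on $[\tau_{j+\frac12},\infty)$ if $\tau_{j+1}=\infty$, in which case the construction stops). If $\tau_{j+1}<\infty$, set $x_{j+1}=x(\tau_{j+1})$ and repeat from $(\tau_{j+1},x_{j+1})$.
   Formalization: The separation τ_{j+1/2}<τ_{j+1} (with τ_{j+1}>0) is stated only for f_d<f_s: for f_d=f_s it can fail, e.g. m=f_d=f_s=1, x_0=0, b=1+w'(t), w=t²(1−cos ln t), where τ_{1/2}=τ_1=0. All other claims are kept for f_d≤f_s. *)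

theory Defs
  imports "HOL-Analysis.Analysis"
begin

definition locally_lipschitz_on :: "'a::metric_space set \<Rightarrow> ('a \<Rightarrow> 'b::metric_space) \<Rightarrow> bool" where
  "locally_lipschitz_on S f \<longleftrightarrow>
     (\<forall>p\<in>S. \<exists>u>0. \<exists>L. L-lipschitz_on (cball p u \<inter> S) f)"

text \<open>
  A motion is represented by a pair of functions: the position and its velocity. Velocities are
  locally Lipschitz, so that positions are continuously differentiable with a locally bounded
  acceleration. The acceleration exists almost everywhere only; it is the
  number \<open>a\<close> below. The force is \<open>b x t\<close>, at position \<open>x\<close> and time \<open>t\<close>.
\<close>

definition vi_solution ::
  "(real \<Rightarrow> real \<Rightarrow> real) \<Rightarrow> real \<Rightarrow> real \<Rightarrow> real \<Rightarrow> real \<Rightarrow> (real \<Rightarrow> real) \<Rightarrow> (real \<Rightarrow> real) \<Rightarrow> bool" where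
  "vi_solution b m fd s \<xi> y w \<longleftrightarrow>
     (\<forall>t\<ge>s. (y has_real_derivative w t) (at t within {s..})) \<and>
     locally_lipschitz_on {s..} w \<and>
     y s = \<xi> \<and> w s = 0 \<and>
     (AE t in lborel. t > s \<longrightarrow>
        (\<exists>a. (w has_real_derivative a) (at t) \<and>
             (\<forall>\<phi>. (b (y t) t - m * a) * (\<phi> - w t) + fd * \<bar>w t\<bar> \<le> fd * \<bar>\<phi>\<bar>)))"

text \<open>
  The time \<open>\<tau> j\<close> is the \<open>j\<close>-th entrance time in static phase and \<open>\<sigma> j\<close> is the entrance
  time in dynamic phase that follows it (it carries the index \<open>j + 1/2\<close> on paper). Once the construction
  stops, all later times are \<open>\<infinity>\<close> by convention. The infimum of the empty set is \<open>\<infinity>\<close> in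
  \<^typ>\<open>ereal\<close>. The pair \<open>x\<close>, \<open>v\<close> is the trajectory with its velocity, and the
  state at time \<open>\<tau> j = s\<close> is \<open>x s\<close>. The condition that the velocity vanishes and the force is
  at most \<open>fs\<close> at each finite \<open>\<tau> j\<close> is not repeated: it holds for \<open>j = 0\<close> by the
  assumption on \<open>x0\<close>, and for later \<open>j\<close> by continuity, \<open>\<tau> j\<close> being the infimum of the times
  at which it holds.
\<close>

definition two_phase_trajectory ::
  "(real \<Rightarrow> real \<Rightarrow> real) \<Rightarrow> real \<Rightarrow> real \<Rightarrow> real \<Rightarrow> real \<Rightarrow>
   (real \<Rightarrow> real) \<Rightarrow> (real \<Rightarrow> real) \<Rightarrow> (nat \<Rightarrow> ereal) \<Rightarrow> (nat \<Rightarrow> ereal) \<Rightarrow> bool" where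
  "two_phase_trajectory b m fd fs x0 x v \<tau> \<sigma> \<longleftrightarrow>
     \<tau> 0 = 0 \<and> x 0 = x0 \<and> v 0 = 0 \<and>
     (\<forall>j. \<tau> j = \<infinity> \<longrightarrow> \<sigma> j = \<infinity>) \<and>
     (\<forall>j. \<sigma> j = \<infinity> \<longrightarrow> \<tau> (Suc j) = \<infinity>) \<and>
     (\<forall>j s. \<tau> j = ereal s \<longrightarrow>
        \<sigma> j = Inf (ereal ` {t. s \<le> t \<and> \<bar>b (x s) t\<bar> > fs}) \<and>
        (\<forall>t. s \<le> t \<and> ereal t < \<sigma> j \<longrightarrow> x t = x s \<and> v t = 0)) \<and>
     (\<forall>j s r. \<tau> j = ereal s \<and> \<sigma> j = ereal r \<longrightarrow>
        (\<exists>y w. vi_solution b m fd r (x s) y w \<and>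
           \<tau> (Suc j) = Inf (ereal ` {t. r < t \<and> w t = 0 \<and> \<bar>b (y t) t\<bar> \<le> fs}) \<and>
           (\<forall>t. r \<le> t \<and> ereal t \<le> \<tau> (Suc j) \<longrightarrow> x t = y t \<and> v t = w t)))"

definition friction_ode_solution ::
  "(real \<Rightarrow> real \<Rightarrow> real) \<Rightarrow> real \<Rightarrow> real \<Rightarrow> real \<Rightarrow> ereal \<Rightarrow> real \<Rightarrow>
   (real \<Rightarrow> real) \<Rightarrow> (real \<Rightarrow> real) \<Rightarrow> bool" where
  "friction_ode_solution b m fd r T \<xi> y w \<longleftrightarrow>
     (let I = {t. r \<le> t \<and> ereal t < T} in
        (\<forall>t\<in>I. (y has_real_derivative w t) (at t within I)) \<and>
        locally_lipschitz_on I w) \<and>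
     y r = \<xi> \<and> w r = 0 \<and>
     (AE t in lborel. r < t \<and> ereal t < T \<longrightarrow>
        (\<exists>a. (w has_real_derivative a) (at t) \<and> m * a + sgn (w t) * fd = b (y t) t))"

end

theory Submission
  imports Defs
begin

text \<open>
  Testing the variational inequality with \<open>\<phi> = 0\<close>, \<open>\<phi> = 2 * w\<close> and \<open>\<phi> = \<plusminus>1\<close> shows that, at almost
  every time, it is Coulomb's law: the friction force \<open>b - m * a\<close> has modulus at most \<open>fd\<close>, and it
  equals \<open>sgn w * fd\<close> as soon as \<open>w \<noteq> 0\<close> (\<open>friction_inclusion\<close>). Everything then rests on
  elementary facts about Lipschitz functions whose derivative is known almost everywhere only.

  \<^item> Separation. A static phase ends at \<open>r\<close> with \<open>\<bar>b\<bar> \<ge> fs > fd\<close>. By continuity \<open>b\<close> beats the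
    friction by a fixed margin shortly after \<open>r\<close>, so the acceleration has the sign of \<open>b\<close> and is
    bounded away from zero almost everywhere. The velocity is therefore strictly monotone after
    \<open>r\<close>, where it vanishes, and it has no zero there (\<open>vi_solution_leaves_rest\<close>). For
    \<open>fd = fs\<close> there is no margin, which is why separation is claimed under \<open>fd < fs\<close>.

  \<^item> Nonzero velocity. Before the next static phase, a zero of the velocity can occur only while
    \<open>\<bar>b\<bar> > fs \<ge> fd\<close>. If the velocity is differentiable there, the bound on the friction force
    excludes \<open>a = 0\<close>. But a function has at most countably many zeros at which its
    derivative exists and differs from zero (\<open>countable_simple_zeros\<close>). So the velocity is nonzero
    almost everywhere, and Coulomb's law turns into the differential equation.

  \<^item> Uniqueness. Friction dissipates: \<open>(w1 - w2) * (sgn w1 - sgn w2) \<ge> 0\<close>. Hence the discontinuous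
    term has the good sign in the derivative of \<open>(y1 - y2)\<^sup>2 + (w1 - w2)\<^sup>2\<close>, and Gronwall's
    inequality applies as if the equation were Lipschitz (\<open>friction_ode_solution_unique\<close>).

  The passage from almost everywhere to everywhere is made by \<open>lipschitz_AE_deriv_pos_imp_le\<close>,
  on which both the separation and the Gronwall estimate depend.
\<close>

section \<open>Lipschitz functions on compact sets\<close>

lemma locally_lipschitz_on_imp_continuous_on:
  assumes "locally_lipschitz_on S f"
  shows "continuous_on S f"
  unfolding continuous_on_eq_continuous_within
proof
  fix p assume p: "p \<in> S"
  then obtain u L where u: "u > 0" "L-lipschitz_on (cball p u \<inter> S) f"
    using assms unfolding locally_lipschitz_on_def by blast
  then have "continuous (at p within cball p u \<inter> S) f"
    using p by (intro lipschitz_on_continuous_within[OF u(2)]) auto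
  moreover have "at p within cball p u \<inter> S = at p within S"
    by (rule at_within_nhd[where S = "ball p u"]) (use u(1) in auto)
  ultimately show "continuous (at p within S) f"
    by simp
qed

lemma locally_lipschitz_on_subset:
  assumes "locally_lipschitz_on S f" "T \<subseteq> S"
  shows "locally_lipschitz_on T f"
  unfolding locally_lipschitz_on_def
proof
  fix p assume "p \<in> T"
  then obtain u L where "u > 0" "L-lipschitz_on (cball p u \<inter> S) f"
    using assms unfolding locally_lipschitz_on_def by blast
  then show "\<exists>u>0. \<exists>L. L-lipschitz_on (cball p u \<inter> T) f"
    using assms(2) by (meson Int_mono lipschitz_on_subset order_refl)
qed

lemma locally_lipschitz_on_compact_imp_lipschitz_on:
  assumes "locally_lipschitz_on S f" "K \<subseteq> S" "compact K"
  shows "\<exists>L. L-lipschitz_on K f"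
proof -
  have "local_lipschitz {0::real} K (\<lambda>_. f)"
  proof (rule local_lipschitzI)
    fix z assume "z \<in> K"
    then show "\<exists>u>0. \<exists>L. \<forall>t\<in>cball t u \<inter> {0::real}. L-lipschitz_on (cball z u \<inter> K) f" for t
      using locally_lipschitz_on_subset[OF assms(1,2)] unfolding locally_lipschitz_on_def by blast
  qed
  then show ?thesis
    using local_lipschitz_compact_implies_lipschitz[of "{0::real}" K "\<lambda>_. f"] assms(3)
    by auto
qed

lemma lipschitz_on_mult_interval:
  fixes f g :: "real \<Rightarrow> real"
  assumes "K-lipschitz_on {a..b} f" "L-lipschitz_on {a..b} g"
  shows "\<exists>M. M-lipschitz_on {a..b} (\<lambda>t. f t * g t)"
proof -
  have "compact (f ` {a..b})" "compact (g ` {a..b})"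
    using assms by (auto intro!: compact_continuous_image lipschitz_on_continuous_on)
  then obtain A B where A: "\<And>t. t \<in> {a..b} \<Longrightarrow> \<bar>f t\<bar> \<le> A"
    and B: "\<And>t. t \<in> {a..b} \<Longrightarrow> \<bar>g t\<bar> \<le> B"
    by (metis compact_imp_bounded bounded_iff imageI real_norm_def)
  have KL: "K \<ge> 0" "L \<ge> 0"
    using assms lipschitz_on_nonneg by blast+
  have "(\<bar>A\<bar> * L + \<bar>B\<bar> * K)-lipschitz_on {a..b} (\<lambda>t. f t * g t)"
  proof (rule lipschitz_onI)
    fix p q assume pq: "p \<in> {a..b}" "q \<in> {a..b}"
    have "f p * g p - f q * g q = f p * (g p - g q) + g q * (f p - f q)"
      by (simp add: algebra_simps)
    then have "\<bar>f p * g p - f q * g q\<bar> \<le> \<bar>f p\<bar> * \<bar>g p - g q\<bar> + \<bar>g q\<bar> * \<bar>f p - f q\<bar>"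
      by (metis abs_mult abs_triangle_ineq)
    also have "\<dots> \<le> \<bar>A\<bar> * (L * \<bar>p - q\<bar>) + \<bar>B\<bar> * (K * \<bar>p - q\<bar>)"
      using lipschitz_onD[OF assms(1) pq] lipschitz_onD[OF assms(2) pq] A[OF pq(1)] B[OF pq(2)]
      by (intro add_mono mult_mono) (auto simp: dist_real_def)
    finally show "dist (f p * g p) (f q * g q) \<le> (\<bar>A\<bar> * L + \<bar>B\<bar> * K) * dist p q"
      by (simp add: dist_real_def algebra_simps)
  qed (use KL in auto)
  then show ?thesis by blast
qed

lemma continuous_derivative_imp_lipschitz_on:
  fixes f :: "real \<Rightarrow> real"
  assumes f: "\<And>t. t \<in> {a..b} \<Longrightarrow> (f has_real_derivative f' t) (at t within {a..b})"
    and f': "continuous_on {a..b} f'"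
  shows "\<exists>L. L-lipschitz_on {a..b} f"
proof -
  have "compact (f' ` {a..b})"
    using f' by (auto intro!: compact_continuous_image)
  then obtain A where A: "\<And>t. t \<in> {a..b} \<Longrightarrow> \<bar>f' t\<bar> \<le> A"
    by (metis compact_imp_bounded bounded_iff imageI real_norm_def)
  have "\<bar>A\<bar>-lipschitz_on {a..b} f"
  proof (rule bounded_derivative_imp_lipschitz)
    fix t assume t: "t \<in> {a..b}"
    show "(f has_derivative (*) (f' t)) (at t within {a..b})"
      using f[OF t] by (simp add: has_field_derivative_def)
    show "onorm ((*) (f' t)) \<le> \<bar>A\<bar>"
      using A[OF t] by (intro onorm_le) (auto simp: abs_mult intro!: mult_right_mono)
  qed auto
  then show ?thesis by blast
qed

section \<open>Lipschitz functions with an almost everywhere prescribed derivative\<close>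

text \<open>
  Near a point where the derivative is nonzero the value is not taken again, so these points are
  isolated from one another; a set of isolated points in a second countable space is countable.
\<close>
lemma countable_simple_zeros:
  fixes f :: "real \<Rightarrow> real"
  shows "countable {t. f t = c \<and> (\<exists>d. d \<noteq> 0 \<and> (f has_real_derivative d) (at t))}"
    (is "countable ?Z")
proof -
  have iso: "\<exists>U. open U \<and> U \<inter> ?Z = {t}" if tZ: "t \<in> ?Z" for t
  proof -
    obtain d where d: "d \<noteq> 0" "(f has_real_derivative d) (at t)" and ft: "f t = c"
      using tZ by auto
    have "((\<lambda>u. (f u - f t) / (u - t)) \<longlongrightarrow> d) (at t)"
      using d(2) by (simp add: has_field_derivative_iff)
    then have "\<forall>\<^sub>F u in at t. (f u - f t) / (u - t) \<noteq> 0"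
      using d(1) by (rule tendsto_imp_eventually_ne)
    then obtain U where "open U" "t \<in> U" "\<And>u. u \<in> U \<Longrightarrow> u \<noteq> t \<Longrightarrow> f u \<noteq> f t"
      unfolding eventually_at_topological by auto
    then have "open U \<and> U \<inter> ?Z = {t}"
      using tZ ft by auto
    then show ?thesis by blast
  qed
  let ?F = "{U. open U \<and> (\<exists>t. U \<inter> ?Z = {t})}"
  obtain F where F: "F \<subseteq> ?F" "countable F" "\<Union>F = \<Union>?F"
    using Lindelof[of ?F] by auto
  have "?Z \<subseteq> (\<lambda>U. the_elem (U \<inter> ?Z)) ` F"
  proof
    fix t assume t: "t \<in> ?Z"
    then obtain V where "V \<in> ?F" "t \<in> V"
      using iso[OF t] by blast
    then obtain U where U: "U \<in> F" "t \<in> U"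
      using F(3) by blast
    then obtain t' where t': "U \<inter> ?Z = {t'}"
      using F(1) by blast
    have "t \<in> {t'}"
      unfolding t'[symmetric] using U(2) t by (rule IntI)
    with t' have "U \<inter> ?Z = {t}"
      by (simp only: singleton_iff)
    then show "t \<in> (\<lambda>U. the_elem (U \<inter> ?Z)) ` F"
      using U(1) by (metis (no_types, lifting) imageI the_elem_eq)
  qed
  then show ?thesis
    using F(2) by (meson countable_image countable_subset)
qed

text \<open>
  A Lipschitz function maps the exceptional null set \<open>N\<close> to a null set. If \<open>f b < f a\<close>, some value
  \<open>c\<close> strictly between the two is thus taken at no point of \<open>N\<close>. At the last point where
  \<open>f = c\<close> the function must come down from \<open>c\<close>, yet its derivative is positive there.
\<close>
lemma lipschitz_AE_deriv_pos_imp_le: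
  fixes f :: "real \<Rightarrow> real"
  assumes lip: "L-lipschitz_on {a..b} f" and "a \<le> b"
    and der: "AE t in lborel. a < t \<and> t < b \<longrightarrow> (\<exists>d>0. (f has_real_derivative d) (at t))"
  shows "f a \<le> f b"
proof (rule ccontr)
  assume "\<not> f a \<le> f b"
  then have fab: "f b < f a" by simp
  obtain N where N: "negligible N"
      "{t. \<not> (a < t \<and> t < b \<longrightarrow> (\<exists>d>0. (f has_real_derivative d) (at t)))} \<subseteq> N"
    using AE_completion[OF der] unfolding eventually_ae_filter_negligible by blast
  have "negligible (f ` (N \<inter> {a..b}))"
  proof (rule negligible_locally_Lipschitz_image)
    show "negligible (N \<inter> {a..b})"
      using N(1) by (rule negligible_subset) auto
    fix t assume "t \<in> N \<inter> {a..b}"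
    then show "\<exists>T B. open T \<and> t \<in> T \<and> (\<forall>u\<in>N \<inter> {a..b} \<inter> T. norm (f u - f t) \<le> B * norm (u - t))"
      using lipschitz_on_normD[OF lip] by (intro exI[of _ UNIV] exI[of _ L]) auto
  qed simp
  moreover have "\<not> negligible {f b<..<f a}"
    using fab by (intro open_not_negligible) auto
  ultimately obtain c where c: "f b < c" "c < f a" "c \<notin> f ` (N \<inter> {a..b})"
    using negligible_subset by (metis greaterThanLessThan_iff subsetI)
  have cont: "continuous_on {a..b} f"
    using lip by (rule lipschitz_on_continuous_on)
  define S where "S = {t \<in> {a..b}. f t = c}"
  have "closed S"
    unfolding S_def using cont by (intro continuous_closed_preimage_constant) auto
  moreover have "bounded S"
    unfolding S_def by (rule bounded_subset[OF bounded_closed_interval[of a b]]) auto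
  ultimately have "compact S"
    by (simp add: compact_eq_bounded_closed)
  moreover have "S \<noteq> {}"
    using IVT2'[of f b c a] c cont \<open>a \<le> b\<close> by (auto simp: S_def)
  ultimately obtain t where t: "t \<in> S" "\<And>u. u \<in> S \<Longrightarrow> u \<le> t"
    using compact_attains_sup[of S] by blast
  have "a < t" "t < b"
    using t(1) c by (auto simp: S_def order.order_iff_strict)
  moreover have "t \<notin> N"
    using t(1) c(3) by (auto simp: S_def)
  ultimately obtain d where d: "d > 0" "(f has_real_derivative d) (at t)"
    using N(2) by blast
  obtain e where e: "e > 0" "\<And>h. 0 < h \<Longrightarrow> h < e \<Longrightarrow> f t < f (t + h)"
    using DERIV_pos_inc_right[OF d(2,1)] by blast
  define h where "h = min e (b - t) / 2"
  have h: "0 < h" "h < e" "t + h < b"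
    using e(1) \<open>t < b\<close> by (auto simp: h_def min_def field_simps)
  define u where "u = t + h"
  have u: "t < u" "u < b" "c < f u"
    using e(2)[OF h(1,2)] h t(1) by (auto simp: u_def S_def)
  then obtain p where "u \<le> p" "p \<le> b" "f p = c"
    using IVT2'[of f b c u] c(1) \<open>a < t\<close> continuous_on_subset[OF cont, of "{u..b}"] by auto
  then have "p \<in> S" "t < p"
    using u \<open>a < t\<close> by (auto simp: S_def)
  then show False
    using t(2) by fastforce
qed

text \<open>
  Adding a linear function of slope slightly above \<open>- c\<close> reduces the claim to the case of a
  positive derivative.
\<close>
lemma lipschitz_AE_deriv_ge_imp_growth:
  fixes f :: "real \<Rightarrow> real"
  assumes lip: "L-lipschitz_on {a..b} f" and "a \<le> b"
    and der: "AE t in lborel. a < t \<and> t < b \<longrightarrow> (\<exists>d\<ge>c. (f has_real_derivative d) (at t))"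
  shows "c * (b - a) \<le> f b - f a"
proof (rule field_le_epsilon)
  fix e :: real assume e: "e > 0"
  \<comment> \<open>The slope \<open>q\<close> costs at most \<open>e\<close> over the interval; the \<open>1\<close> in its denominator covers \<open>a = b\<close>.\<close>
  define q where "q = e / (b - a + 1)"
  have q: "q > 0" "q * (b - a) \<le> e"
    using e \<open>a \<le> b\<close> by (auto simp: q_def field_simps)
  define k where "k = q - c"
  define g where "g = (\<lambda>t. f t + k * t)"
  have "(L + \<bar>k\<bar> * 1)-lipschitz_on {a..b} g"
    unfolding g_def by (intro lipschitz_on_add[OF lip] lipschitz_on_cmult_real lipschitz_on_id)
  moreover have "AE t in lborel. a < t \<and> t < b \<longrightarrow> (\<exists>d>0. (g has_real_derivative d) (at t))"
    using der
  proof eventually_elim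
    case (elim t)
    show ?case
    proof
      assume "a < t \<and> t < b"
      with elim obtain d where d: "d \<ge> c" "(f has_real_derivative d) (at t)" by blast
      have "(g has_real_derivative d + k) (at t)"
        unfolding g_def using d(2) by (auto intro!: derivative_eq_intros)
      moreover have "d + k > 0"
        using d(1) q(1) by (simp add: k_def)
      ultimately show "\<exists>d>0. (g has_real_derivative d) (at t)" by blast
    qed
  qed
  ultimately have "g a \<le> g b"
    using lipschitz_AE_deriv_pos_imp_le \<open>a \<le> b\<close> by blast
  then have "c * (b - a) \<le> f b - f a + q * (b - a)"
    by (simp add: g_def k_def algebra_simps)
  then show "c * (b - a) \<le> f b - f a + e"
    using q(2) by simp
qed

text \<open>The function \<open>- exp (- C * t) * e t\<close> has a nonnegative derivative almost everywhere.\<close>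
lemma gronwall_AE_zero:
  fixes e :: "real \<Rightarrow> real"
  assumes lip: "L-lipschitz_on {a..b} e" and "a \<le> b" and "e a = 0"
    and der: "AE t in lborel. a < t \<and> t < b \<longrightarrow> (\<exists>d \<le> C * e t. (e has_real_derivative d) (at t))"
  shows "e b \<le> 0"
proof -
  define g where "g = (\<lambda>t. - exp (- C * t) * e t)"
  have "\<exists>K. K-lipschitz_on {a..b} (\<lambda>t. - exp (- C * t))"
    by (rule continuous_derivative_imp_lipschitz_on[where f' = "\<lambda>t. C * exp (- C * t)"])
       (auto intro!: derivative_eq_intros continuous_intros)
  then obtain M where "M-lipschitz_on {a..b} g"
    unfolding g_def using lipschitz_on_mult_interval lip by blast
  moreover have "AE t in lborel. a < t \<and> t < b \<longrightarrow> (\<exists>d\<ge>0. (g has_real_derivative d) (at t))"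
    using der
  proof eventually_elim
    case (elim t)
    show ?case
    proof
      assume "a < t \<and> t < b"
      with elim obtain d where d: "d \<le> C * e t" "(e has_real_derivative d) (at t)" by blast
      have "(g has_real_derivative exp (- C * t) * (C * e t - d)) (at t)"
        unfolding g_def using d(2) by (auto intro!: derivative_eq_intros simp: algebra_simps)
      moreover have "exp (- C * t) * (C * e t - d) \<ge> 0"
        using d(1) by simp
      ultimately show "\<exists>d\<ge>0. (g has_real_derivative d) (at t)" by blast
    qed
  qed
  ultimately have "0 * (b - a) \<le> g b - g a"
    using lipschitz_AE_deriv_ge_imp_growth \<open>a \<le> b\<close> by blast
  then show ?thesis
    using \<open>e a = 0\<close> by (simp add: g_def mult_le_0_iff)
qed

section \<open>The variational inequality at a single time\<close>

text \<open>
  Here \<open>\<beta>\<close> stands for the friction force \<open>b - m * a\<close>. The test values \<open>0\<close> and \<open>2 * w\<close> give the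
  power balance \<open>\<beta> * w = fd * \<bar>w\<bar>\<close>, which removes \<open>w\<close> from the inequality.
\<close>
lemma friction_inclusion:
  fixes \<beta> fd w :: real
  assumes "\<And>\<phi>. \<beta> * (\<phi> - w) + fd * \<bar>w\<bar> \<le> fd * \<bar>\<phi>\<bar>"
  shows "\<bar>\<beta>\<bar> \<le> fd" and "w \<noteq> 0 \<Longrightarrow> \<beta> = sgn w * fd"
proof -
  have eq: "\<beta> * w = fd * \<bar>w\<bar>"
    using assms[of 0] assms[of "2 * w"] by (simp add: abs_mult)
  then have "\<beta> * \<phi> \<le> fd * \<bar>\<phi>\<bar>" for \<phi>
    using assms[of \<phi>] by (simp add: algebra_simps)
  from this[of 1] this[of "-1"] show "\<bar>\<beta>\<bar> \<le> fd" by auto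
  have "\<beta> * w = (sgn w * fd) * w"
    using eq by (simp add: abs_sgn mult_ac)
  then show "\<beta> = sgn w * fd" if "w \<noteq> 0"
    using that by simp
qed

section \<open>Leaving the static phase\<close>

lemma continuous_on_force_along:
  fixes b :: "real \<Rightarrow> real \<Rightarrow> real"
  assumes "locally_lipschitz_on (UNIV \<times> {0..}) (\<lambda>(z, t). b z t)"
    and "continuous_on S y" "S \<subseteq> {0..}"
  shows "continuous_on S (\<lambda>t. b (y t) t)"
proof -
  have "continuous_on S (\<lambda>t. (y t, t))"
    using assms(2) by (intro continuous_on_Pair continuous_on_id)
  moreover have "(\<lambda>t. (y t, t)) ` S \<subseteq> UNIV \<times> {0..}"
    using assms(3) by auto
  ultimately have "continuous_on S (\<lambda>t. (\<lambda>(z, t). b z t) (y t, t))"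
    by (rule continuous_on_compose2[OF locally_lipschitz_on_imp_continuous_on[OF assms(1)]])
  then show ?thesis by simp
qed

text \<open>
  If the force were below the threshold at the infimum, it would stay below it on a whole
  interval to the right, and the infimum would be larger.
\<close>
lemma first_exceedance_force_ge:
  fixes b :: "real \<Rightarrow> real \<Rightarrow> real"
  assumes lip: "locally_lipschitz_on (UNIV \<times> {0..}) (\<lambda>(z, t). b z t)" and "0 \<le> s" "s \<le> r"
    and r: "ereal r = Inf (ereal ` {t. s \<le> t \<and> \<bar>b z t\<bar> > fs})"
  shows "\<bar>b z r\<bar> \<ge> fs"
proof (rule ccontr)
  assume "\<not> \<bar>b z r\<bar> \<ge> fs"
  then have gap: "fs - \<bar>b z r\<bar> > 0" by simp
  have "continuous_on {0..} (b z)"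
    by (intro continuous_on_force_along[OF lip, of _ "\<lambda>_. z"]) auto
  then obtain d where d: "d > 0"
      "\<And>t. t \<in> {0..} \<Longrightarrow> dist t r < d \<Longrightarrow> dist (b z t) (b z r) < fs - \<bar>b z r\<bar>"
    using gap \<open>0 \<le> s\<close> \<open>s \<le> r\<close> unfolding continuous_on_iff by (meson atLeast_iff order_trans)
  have "ereal (r + d) \<le> Inf (ereal ` {t. s \<le> t \<and> \<bar>b z t\<bar> > fs})"
  proof (rule Inf_greatest)
    fix T assume T: "T \<in> ereal ` {t. s \<le> t \<and> \<bar>b z t\<bar> > fs}"
    then obtain t where t: "T = ereal t" "s \<le> t" "\<bar>b z t\<bar> > fs" by blast
    have "ereal r \<le> T"
      unfolding r using T by (rule Inf_lower)
    then have "r + d \<le> t"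
      using d(2)[of t] t \<open>0 \<le> s\<close> by (auto simp: dist_real_def not_less[symmetric])
    then show "ereal (r + d) \<le> T"
      by (simp add: t(1))
  qed
  then show False
    using d(1) r by (metis ereal_less_eq(3) add_le_same_cancel1 not_less)
qed

text \<open>
  A force exceeding the dynamic friction accelerates the body in its own direction at a rate
  bounded below, whatever the current velocity, since the friction force never exceeds \<open>fd\<close>.
\<close>
lemma vi_solution_leaves_rest:
  assumes vi: "vi_solution b m fd r \<xi> y w" and "r \<ge> 0" "m > 0"
    and lip: "locally_lipschitz_on (UNIV \<times> {0..}) (\<lambda>(z, t). b z t)"
    and large: "\<bar>b \<xi> r\<bar> > fd" and "fd > 0"
  shows "\<exists>\<delta>>0. \<forall>t. r < t \<and> t \<le> r + \<delta> \<longrightarrow> w t \<noteq> 0"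
proof -
  \<comment> \<open>The sign \<open>\<eta>\<close> of the force treats both directions at once; half of the excess force, \<open>c\<close>,
    survives near \<open>r\<close> by continuity.\<close>
  define \<eta> where "\<eta> = sgn (b \<xi> r)"
  define c where "c = (\<bar>b \<xi> r\<bar> - fd) / 2"
  have c: "c > 0" and \<eta>: "\<eta> * b \<xi> r = \<bar>b \<xi> r\<bar>" "\<bar>\<eta>\<bar> = 1"
    using large \<open>fd > 0\<close> by (auto simp: c_def \<eta>_def abs_sgn mult.commute abs_sgn_eq)
  have init: "y r = \<xi>" "w r = 0"
    using vi by (auto simp: vi_solution_def)
  have "continuous_on {r..} y"
    using vi unfolding vi_solution_def by (intro DERIV_continuous_on[where D = w]) auto
  then have "continuous_on {r..} (\<lambda>t. b (y t) t)"
    using \<open>r \<ge> 0\<close> by (intro continuous_on_force_along[OF lip]) auto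
  then have "continuous_on {r..} (\<lambda>t. \<eta> * b (y t) t)"
    by (rule continuous_on_mult_left)
  then obtain d where d: "d > 0"
      "\<And>t. t \<in> {r..} \<Longrightarrow> dist t r < d \<Longrightarrow> dist (\<eta> * b (y t) t) (\<eta> * b (y r) r) < c"
    using c unfolding continuous_on_iff by (meson atLeast_iff order_refl)
  have force: "fd + c < \<eta> * b (y t) t" if "r \<le> t" "t < r + d" for t
  proof -
    have "\<eta> * b (y r) r - c < \<eta> * b (y t) t"
      using d(2)[of t] that by (auto simp: dist_real_def)
    then show ?thesis
      using \<eta>(1) init(1) by (simp add: c_def field_simps)
  qed
  have "w t \<noteq> 0" if t: "r < t" "t \<le> r + d / 2" for t
  proof -
    obtain L where "L-lipschitz_on {r..t} w"
      using vi locally_lipschitz_on_compact_imp_lipschitz_on[of "{r..}" w "{r..t}"]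
      unfolding vi_solution_def by auto
    then have "(\<bar>\<eta>\<bar> * L)-lipschitz_on {r..t} (\<lambda>t. \<eta> * w t)"
      by (rule lipschitz_on_cmult_real)
    moreover have "AE u in lborel. r < u \<longrightarrow>
        (\<exists>a. (w has_real_derivative a) (at u) \<and>
             (\<forall>\<phi>. (b (y u) u - m * a) * (\<phi> - w u) + fd * \<bar>w u\<bar> \<le> fd * \<bar>\<phi>\<bar>))"
      using vi by (simp add: vi_solution_def)
    then have "AE u in lborel. r < u \<and> u < t \<longrightarrow>
        (\<exists>a\<ge>c / m. ((\<lambda>t. \<eta> * w t) has_real_derivative a) (at u))"
    proof eventually_elim
      case (elim u)
      show ?case
      proof
        assume u: "r < u \<and> u < t"
        then obtain a where a: "(w has_real_derivative a) (at u)"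
            "\<And>\<phi>. (b (y u) u - m * a) * (\<phi> - w u) + fd * \<bar>w u\<bar> \<le> fd * \<bar>\<phi>\<bar>"
          using elim by blast
        have "\<eta> * (b (y u) u - m * a) \<le> \<bar>\<eta> * (b (y u) u - m * a)\<bar>"
          by (rule abs_ge_self)
        also have "\<dots> \<le> fd"
          using friction_inclusion(1)[OF a(2)] \<eta>(2) by (simp add: abs_mult)
        finally have "c \<le> m * (\<eta> * a)"
          using force[of u] u t d(1) by (simp add: algebra_simps)
        then have "c / m \<le> \<eta> * a"
          using \<open>m > 0\<close> by (simp add: field_simps)
        moreover have "((\<lambda>t. \<eta> * w t) has_real_derivative \<eta> * a) (at u)"
          using a(1) by (auto intro!: derivative_eq_intros)
        ultimately show "\<exists>a\<ge>c / m. ((\<lambda>t. \<eta> * w t) has_real_derivative a) (at u)"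
          by blast
      qed
    qed
    ultimately have "c / m * (t - r) \<le> \<eta> * w t - \<eta> * w r"
      using t(1) by (intro lipschitz_AE_deriv_ge_imp_growth) auto
    moreover have "c / m * (t - r) > 0"
      using c \<open>m > 0\<close> t(1) by simp
    ultimately show ?thesis
      using init(2) by auto
  qed
  then show ?thesis
    using d(1) by (intro exI[of _ "d / 2"]) auto
qed

section \<open>Uniqueness for the equation with friction\<close>

text \<open>
  Solutions remain in a compact set on bounded time intervals, so the local Lipschitz condition on
  the force provides the uniform constant that the Gronwall estimate needs.
\<close>
lemma force_lipschitz_in_position:
  fixes b :: "real \<Rightarrow> real \<Rightarrow> real"
  assumes lip: "locally_lipschitz_on (UNIV \<times> {0..}) (\<lambda>(z, t). b z t)" and "r \<ge> 0"
    and "compact K"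
  shows "\<exists>L\<ge>0. \<forall>t\<in>{r..q}. L-lipschitz_on K (\<lambda>z. b z t)"
proof -
  have "local_lipschitz {0..} UNIV (\<lambda>t z. b z t)"
  proof (rule local_lipschitzI)
    fix t z :: real assume "t \<in> {0..}"
    then obtain u L where u: "u > 0"
        "L-lipschitz_on (cball (z, t) u \<inter> UNIV \<times> {0..}) (\<lambda>(z, t). b z t)"
      using lip unfolding locally_lipschitz_on_def by (metis SigmaI UNIV_I)
    have box: "(z', t') \<in> cball (z, t) u" if "t' \<in> cball t (u / 2)" "z' \<in> cball z (u / 2)" for z' t'
      using that sqrt_sum_squares_le_sum_abs[of "dist z z'" "dist t t'"]
      by (auto simp: dist_Pair_Pair)
    have "L-lipschitz_on (cball z (u / 2) \<inter> UNIV) (\<lambda>z. b z t')"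
      if t': "t' \<in> cball t (u / 2) \<inter> {0..}" for t'
    proof (rule lipschitz_onI)
      fix z1 z2 assume "z1 \<in> cball z (u / 2) \<inter> UNIV" "z2 \<in> cball z (u / 2) \<inter> UNIV"
      then show "dist (b z1 t') (b z2 t') \<le> L * dist z1 z2"
        using lipschitz_onD[OF u(2), of "(z1, t')" "(z2, t')"] box t' by (auto simp: dist_Pair_Pair)
    qed (use u(2) lipschitz_on_nonneg in blast)
    then show "\<exists>u>0. \<exists>L. \<forall>t'\<in>cball t u \<inter> {0..}. L-lipschitz_on (cball z u \<inter> UNIV) (\<lambda>z. b z t')"
      using u(1) by (intro exI[of _ "u / 2"] conjI exI[of _ L] ballI) auto
  qed
  then have "local_lipschitz {r..q} K (\<lambda>t z. b z t)"
    by (rule local_lipschitz_subset) (use \<open>r \<ge> 0\<close> in auto)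
  moreover have "continuous_on {r..q} (\<lambda>t. b z t)" for z
    using \<open>r \<ge> 0\<close> by (intro continuous_on_force_along[OF lip]) auto
  ultimately obtain L where "\<And>t. t \<in> {r..q} \<Longrightarrow> L-lipschitz_on K (\<lambda>z. b z t)"
    using local_lipschitz_compact_implies_lipschitz[of "{r..q}" K "\<lambda>t z. b z t"] \<open>compact K\<close>
    by (metis compact_Icc)
  then have "\<forall>t\<in>{r..q}. \<bar>L\<bar>-lipschitz_on K (\<lambda>z. b z t)"
    by (meson abs_ge_self lipschitz_on_le)
  then show ?thesis
    by (intro exI[of _ "\<bar>L\<bar>"]) simp
qed

text \<open>
  The left-hand side is the derivative of \<open>(y1 - y2)\<^sup>2 + (w1 - w2)\<^sup>2\<close> along two solutions. The
  friction terms only decrease it because \<open>sgn\<close> is monotone; the remaining products are bounded by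
  \<open>2 * \<bar>W\<bar> * \<bar>Y\<bar> \<le> Y\<^sup>2 + W\<^sup>2\<close>.
\<close>
lemma friction_ode_energy_estimate:
  fixes m fd L \<beta>1 \<beta>2 y1 y2 w1 w2 a1 a2 :: real
  assumes "m > 0" "fd \<ge> 0" and \<beta>: "\<bar>\<beta>1 - \<beta>2\<bar> \<le> L * \<bar>y1 - y2\<bar>" "L \<ge> 0"
    and a: "m * a1 + sgn w1 * fd = \<beta>1" "m * a2 + sgn w2 * fd = \<beta>2"
  shows "2 * (y1 - y2) * (w1 - w2) + 2 * (w1 - w2) * (a1 - a2)
    \<le> (1 + L / m) * ((y1 - y2)\<^sup>2 + (w1 - w2)\<^sup>2)"
proof -
  define Y where "Y = y1 - y2"
  define W where "W = w1 - w2"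
  have dissip: "0 \<le> W * (sgn w1 - sgn w2)"
    by (auto simp: W_def sgn_if mult_le_0_iff zero_le_mult_iff)
  have YW: "2 * (\<bar>W\<bar> * \<bar>Y\<bar>) \<le> Y\<^sup>2 + W\<^sup>2"
    using sum_squares_bound[of "\<bar>W\<bar>" "\<bar>Y\<bar>"] by (simp add: algebra_simps)
  have "m * (W * (a1 - a2)) = W * (\<beta>1 - \<beta>2) - fd * (W * (sgn w1 - sgn w2))"
    unfolding a[symmetric] by (simp add: algebra_simps)
  also have "\<dots> \<le> W * (\<beta>1 - \<beta>2)"
    using dissip \<open>fd \<ge> 0\<close> by simp
  also have "\<dots> \<le> \<bar>W\<bar> * \<bar>\<beta>1 - \<beta>2\<bar>"
    by (metis abs_ge_self abs_mult)
  also have "\<dots> \<le> \<bar>W\<bar> * (L * \<bar>Y\<bar>)"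
    using \<beta>(1) by (intro mult_left_mono) (auto simp: Y_def)
  finally have "2 * (W * (a1 - a2)) \<le> L / m * (2 * (\<bar>W\<bar> * \<bar>Y\<bar>))"
    using \<open>m > 0\<close> by (simp add: field_simps)
  also have "\<dots> \<le> L / m * (Y\<^sup>2 + W\<^sup>2)"
    using YW \<open>m > 0\<close> \<open>L \<ge> 0\<close> by (intro mult_left_mono) auto
  finally have "2 * (W * (a1 - a2)) \<le> L / m * (Y\<^sup>2 + W\<^sup>2)" .
  moreover have "2 * (Y * W) \<le> 2 * (\<bar>W\<bar> * \<bar>Y\<bar>)"
    by (metis abs_ge_self abs_mult mult.commute mult_left_mono zero_le_numeral)
  ultimately show ?thesis
    using YW unfolding Y_def[symmetric] W_def[symmetric] by (simp add: algebra_simps)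
qed

lemma friction_ode_solution_unique:
  assumes sol1: "friction_ode_solution b m fd r T \<xi> y1 w1"
    and sol2: "friction_ode_solution b m fd r T \<xi> y2 w2"
    and "m > 0" "fd \<ge> 0" "r \<ge> 0"
    and lip: "locally_lipschitz_on (UNIV \<times> {0..}) (\<lambda>(z, t). b z t)"
    and q: "r \<le> q" "ereal q < T"
  shows "y1 q = y2 q \<and> w1 q = w2 q"
proof -
  define I where "I = {t. r \<le> t \<and> ereal t < T}"
  have sub: "{r..q} \<subseteq> I"
    using q(2) unfolding I_def by (auto intro: le_less_trans[of _ "ereal q"])
  have der: "(y1 has_real_derivative w1 t) (at t within {r..q})"
      "(y2 has_real_derivative w2 t) (at t within {r..q})" if "t \<in> {r..q}" for t
    using sol1 sol2 that sub DERIV_subset unfolding friction_ode_solution_def Let_def I_def[symmetric]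
    by blast+
  obtain K1 K2 where K: "K1-lipschitz_on {r..q} w1" "K2-lipschitz_on {r..q} w2"
    using sol1 sol2 locally_lipschitz_on_compact_imp_lipschitz_on[OF _ sub compact_Icc]
    unfolding friction_ode_solution_def Let_def I_def[symmetric] by blast
  have "compact (y1 ` {r..q} \<union> y2 ` {r..q})"
    using der by (intro compact_Un compact_continuous_image DERIV_continuous_on) auto
  from force_lipschitz_in_position[OF lip \<open>r \<ge> 0\<close> this]
  obtain L where L: "L \<ge> 0"
      "\<And>t. t \<in> {r..q} \<Longrightarrow> L-lipschitz_on (y1 ` {r..q} \<union> y2 ` {r..q}) (\<lambda>z. b z t)"
    by blast
  define Y where "Y = (\<lambda>t. y1 t - y2 t)"
  define W where "W = (\<lambda>t. w1 t - w2 t)"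
  define e where "e = (\<lambda>t. Y t * Y t + W t * W t)"
  have lipW: "(K1 + K2)-lipschitz_on {r..q} W"
    unfolding W_def by (intro lipschitz_intros K)
  obtain KY where lipY: "KY-lipschitz_on {r..q} Y"
    using der lipschitz_on_continuous_on[OF lipW]
      continuous_derivative_imp_lipschitz_on[of r q Y W]
    by (auto simp: Y_def W_def intro!: derivative_eq_intros)
  obtain KYY KWW where "KYY-lipschitz_on {r..q} (\<lambda>t. Y t * Y t)"
      "KWW-lipschitz_on {r..q} (\<lambda>t. W t * W t)"
    using lipschitz_on_mult_interval[OF lipY lipY] lipschitz_on_mult_interval[OF lipW lipW] by blast
  then have "(KYY + KWW)-lipschitz_on {r..q} e"
    unfolding e_def by (rule lipschitz_on_add)
  moreover have "AE t in lborel. r < t \<and> t < q \<longrightarrow>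
      (\<exists>d \<le> (1 + L / m) * e t. (e has_real_derivative d) (at t))"
  proof -
    have "AE t in lborel. r < t \<and> ereal t < T \<longrightarrow>
        (\<exists>a. (w1 has_real_derivative a) (at t) \<and> m * a + sgn (w1 t) * fd = b (y1 t) t)"
      "AE t in lborel. r < t \<and> ereal t < T \<longrightarrow>
        (\<exists>a. (w2 has_real_derivative a) (at t) \<and> m * a + sgn (w2 t) * fd = b (y2 t) t)"
      using sol1 sol2 by (auto simp: friction_ode_solution_def)
    then show ?thesis
    proof eventually_elim
      case (elim t)
      show ?case
      proof
        assume t: "r < t \<and> t < q"
        then have tq: "t \<in> {r..q}" and "ereal t < T"
          using q(2) by (auto intro: less_trans[of _ "ereal q"])
        with elim t obtain a1 a2 where
            a1: "(w1 has_real_derivative a1) (at t)" "m * a1 + sgn (w1 t) * fd = b (y1 t) t"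
          and a2: "(w2 has_real_derivative a2) (at t)" "m * a2 + sgn (w2 t) * fd = b (y2 t) t"
          by blast
        have "at t within {r..q} = at t"
          using t by (intro at_within_interior) auto
        then have "(y1 has_real_derivative w1 t) (at t)" "(y2 has_real_derivative w2 t) (at t)"
          using der[OF tq] by simp_all
        then have "(e has_real_derivative
            2 * (y1 t - y2 t) * (w1 t - w2 t) + 2 * (w1 t - w2 t) * (a1 - a2)) (at t)"
          unfolding e_def Y_def W_def using a1(1) a2(1)
          by (auto intro!: derivative_eq_intros simp: algebra_simps)
        moreover have "\<bar>b (y1 t) t - b (y2 t) t\<bar> \<le> L * \<bar>y1 t - y2 t\<bar>"
          using lipschitz_onD[OF L(2)[OF tq], of "y1 t" "y2 t"] tq by (auto simp: dist_real_def)
        ultimately show "\<exists>d \<le> (1 + L / m) * e t. (e has_real_derivative d) (at t)"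
          using friction_ode_energy_estimate[OF \<open>m > 0\<close> \<open>fd \<ge> 0\<close> _ \<open>L \<ge> 0\<close> a1(2) a2(2)]
          unfolding e_def Y_def W_def power2_eq_square by blast
      qed
    qed
  qed
  moreover have "e r = 0"
    using sol1 sol2 by (auto simp: e_def Y_def W_def friction_ode_solution_def)
  ultimately have "e q \<le> 0"
    using q(1) gronwall_AE_zero by blast
  then have "Y q = 0 \<and> W q = 0"
    unfolding e_def using sum_squares_le_zero_iff by blast
  then show ?thesis
    by (simp add: Y_def W_def)
qed

section \<open>The phases of the trajectory\<close>

lemma two_phase_dynamic_phase:
  assumes "two_phase_trajectory b m fd fs x0 x v \<tau> \<sigma>" "\<tau> j = ereal s" "\<sigma> j = ereal r"
  shows "\<exists>y w. vi_solution b m fd r (x s) y w \<and>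
    \<tau> (Suc j) = Inf (ereal ` {t. r < t \<and> w t = 0 \<and> \<bar>b (y t) t\<bar> \<le> fs}) \<and>
    (\<forall>t. r \<le> t \<and> ereal t \<le> \<tau> (Suc j) \<longrightarrow> x t = y t \<and> v t = w t)"
  using assms unfolding two_phase_trajectory_def by blast

text \<open>
  The regularity of the force is known for nonnegative times only, so every entrance time has to be
  placed in that range.
\<close>
lemma two_phase_times_nonneg:
  assumes traj: "two_phase_trajectory b m fd fs x0 x v \<tau> \<sigma>"
  shows "0 \<le> \<tau> j" and "\<tau> j \<le> \<sigma> j"
proof -
  have \<sigma>: "\<tau> i \<le> \<sigma> i" if "0 \<le> \<tau> i" for i
  proof (cases "\<tau> i")
    case (real s)
    then have "\<sigma> i = Inf (ereal ` {t. s \<le> t \<and> \<bar>b (x s) t\<bar> > fs})"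
      using traj unfolding two_phase_trajectory_def by blast
    then show ?thesis
      unfolding real by (auto intro!: Inf_greatest)
  next
    case PInf
    then show ?thesis
      using traj by (simp add: two_phase_trajectory_def)
  qed (use that in simp)
  show \<tau>: "0 \<le> \<tau> j"
  proof (induction j)
    case 0
    then show ?case using traj by (simp add: two_phase_trajectory_def)
  next
    case (Suc i)
    from \<sigma>[OF Suc] Suc have pos: "0 \<le> \<sigma> i" by (rule order_trans[rotated])
    show ?case
    proof (cases "\<sigma> i")
      case (real r)
      obtain s where s: "\<tau> i = ereal s"
        using Suc \<sigma>[OF Suc] real by (cases "\<tau> i") auto
      obtain y w :: "real \<Rightarrow> real" where "\<tau> (Suc i) = Inf (ereal ` {t. r < t \<and> w t = 0 \<and> \<bar>b (y t) t\<bar> \<le> fs})"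
        using two_phase_dynamic_phase[OF traj s real] by blast
      then show ?thesis
        using pos real by (auto intro!: Inf_greatest)
    next
      case PInf
      then show ?thesis
        using traj by (simp add: two_phase_trajectory_def)
    qed (use pos in simp)
  qed
  show "\<tau> j \<le> \<sigma> j"
    using \<sigma> \<tau> by blast
qed

section \<open>From the variational inequality to the differential equation\<close>

text \<open>
  Where the velocity vanishes the force exceeds what friction can balance, so the acceleration, if
  it exists, is nonzero. Such zeros are countable, hence negligible; elsewhere the friction force is
  \<open>sgn (w t) * fd\<close>.
\<close>
lemma vi_solution_AE_friction_ode:
  assumes vi: "vi_solution b m fd r \<xi> y w" and "m > 0"
    and slip: "\<And>t. r < t \<Longrightarrow> ereal t < T \<Longrightarrow> w t = 0 \<Longrightarrow> \<bar>b (y t) t\<bar> > fd"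
  shows "AE t in lborel. r < t \<and> ereal t < T \<longrightarrow> w t \<noteq> 0 \<and>
    (\<exists>a. (w has_real_derivative a) (at t) \<and> m * a + sgn (w t) * fd = b (y t) t)"
proof -
  have "AE t in lborel. t \<notin> {t. w t = 0 \<and> (\<exists>a. a \<noteq> 0 \<and> (w has_real_derivative a) (at t))}"
    by (intro AE_not_in countable_imp_null_set_lborel countable_simple_zeros)
  moreover have "AE t in lborel. r < t \<longrightarrow>
      (\<exists>a. (w has_real_derivative a) (at t) \<and>
           (\<forall>\<phi>. (b (y t) t - m * a) * (\<phi> - w t) + fd * \<bar>w t\<bar> \<le> fd * \<bar>\<phi>\<bar>))"
    using vi by (simp add: vi_solution_def)
  ultimately show ?thesis
  proof eventually_elim
    case (elim t)
    show ?case
    proof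
      assume t: "r < t \<and> ereal t < T"
      then obtain a where a: "(w has_real_derivative a) (at t)"
          "\<And>\<phi>. (b (y t) t - m * a) * (\<phi> - w t) + fd * \<bar>w t\<bar> \<le> fd * \<bar>\<phi>\<bar>"
        using elim by blast
      have "w t \<noteq> 0"
      proof
        assume "w t = 0"
        moreover from this have "\<bar>b (y t) t\<bar> > fd"
          using slip t by blast
        then have "a \<noteq> 0"
          using friction_inclusion(1)[OF a(2)] by auto
        ultimately show False
          using elim a(1) by blast
      qed
      moreover have "m * a + sgn (w t) * fd = b (y t) t"
        using friction_inclusion(2)[OF a(2)] calculation by simp
      ultimately show "w t \<noteq> 0 \<and>
          (\<exists>a. (w has_real_derivative a) (at t) \<and> m * a + sgn (w t) * fd = b (y t) t)"
        using a(1) by blast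
    qed
  qed
qed

lemma has_real_derivative_cong_on_interval:
  fixes f g :: "real \<Rightarrow> real"
  assumes "(f has_real_derivative d) (at t)" "r < t" "ereal t < T"
    and eq: "\<And>u. r < u \<Longrightarrow> ereal u < T \<Longrightarrow> f u = g u"
  shows "(g has_real_derivative d) (at t)"
proof -
  obtain p where p: "ereal t < ereal p" "ereal p < T"
    using \<open>ereal t < T\<close> ereal_dense2 by blast
  show ?thesis
  proof (rule has_field_derivative_transform_within_open[OF assms(1), of "{r<..<p}"])
    fix u assume "u \<in> {r<..<p}"
    then show "f u = g u"
      using p(2) by (intro eq) (auto intro: less_trans[of _ "ereal p"])
  qed (use p \<open>r < t\<close> in auto)
qed

text \<open>
  A trajectory is tied to the solution of the variational inequality up to the time \<open>T\<close> only and is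
  arbitrary afterwards; derivatives are transferred on the open interval before \<open>T\<close>.
\<close>
lemma friction_ode_solution_from_vi:
  assumes vi: "vi_solution b m fd r \<xi> y w" and "ereal r \<le> T"
    and ode: "AE t in lborel. r < t \<and> ereal t < T \<longrightarrow>
      (\<exists>a. (w has_real_derivative a) (at t) \<and> m * a + sgn (w t) * fd = b (y t) t)"
    and eq: "\<And>t. r \<le> t \<Longrightarrow> ereal t \<le> T \<Longrightarrow> x t = y t \<and> v t = w t"
  shows "friction_ode_solution b m fd r T \<xi> x v"
proof -
  define I where "I = {t. r \<le> t \<and> ereal t < T}"
  have I: "I \<subseteq> {r..}" and eqI: "x t = y t" "v t = w t" if "t \<in> I" for t
    using that eq by (auto simp: I_def less_imp_le)
  have "(x has_real_derivative v t) (at t within I)" if t: "t \<in> I" for t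
  proof -
    have "(y has_real_derivative w t) (at t within I)"
      using vi t unfolding vi_solution_def
      by (meson DERIV_subset I atLeast_iff subsetD)
    then show ?thesis
      using has_field_derivative_transform_within[of y "w t" t I 1 x] eqI t by auto
  qed
  moreover have "locally_lipschitz_on I v"
  proof -
    have "locally_lipschitz_on I w"
      using vi unfolding vi_solution_def
      by (auto intro: locally_lipschitz_on_subset simp: I_def)
    then show ?thesis
      unfolding locally_lipschitz_on_def
      by (metis IntD2 eqI(2) lipschitz_on_transform)
  qed
  moreover have "x r = \<xi>" "v r = 0"
    using eq[of r] \<open>ereal r \<le> T\<close> vi by (auto simp: vi_solution_def)
  moreover have "AE t in lborel. r < t \<and> ereal t < T \<longrightarrow>
      (\<exists>a. (v has_real_derivative a) (at t) \<and> m * a + sgn (v t) * fd = b (x t) t)"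
    using ode
  proof eventually_elim
    case (elim t)
    show ?case
    proof
      assume t: "r < t \<and> ereal t < T"
      then obtain a where a: "(w has_real_derivative a) (at t)"
          "m * a + sgn (w t) * fd = b (y t) t"
        using elim by blast
      have "(v has_real_derivative a) (at t)"
      proof (rule has_real_derivative_cong_on_interval[OF a(1)])
        show "w u = v u" if "r < u" "ereal u < T" for u
          using eq[of u] that by simp
      qed (use t in auto)
      moreover have "x t = y t" "v t = w t"
        using eq[of t] t by auto
      ultimately show "\<exists>a. (v has_real_derivative a) (at t) \<and> m * a + sgn (v t) * fd = b (x t) t"
        using a(2) by auto
    qed
  qed
  ultimately show ?thesis
    unfolding friction_ode_solution_def Let_def I_def[symmetric] by blast
qed

section \<open>The dynamic phase\<close>

theorem proposition1:
  fixes b :: "real \<Rightarrow> real \<Rightarrow> real" and m fd fs x0 s r :: real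
    and x v :: "real \<Rightarrow> real" and \<tau> \<sigma> :: "nat \<Rightarrow> ereal" and j :: nat
  assumes "m > 0" and "fd > 0" and "fs > 0" and "fd \<le> fs"
    and "locally_lipschitz_on (UNIV \<times> {0..}) (\<lambda>(z, t). b z t)"
    and "\<exists>K. \<forall>z. \<forall>t\<ge>0. \<bar>b z t\<bar> \<le> K * (1 + \<bar>z\<bar> + t)"
    and "\<bar>b x0 0\<bar> \<le> fs"
    and "two_phase_trajectory b m fd fs x0 x v \<tau> \<sigma>"
    and "\<tau> j = ereal s" and "\<sigma> j = ereal r"
  shows "(fd < fs \<longrightarrow> \<sigma> j < \<tau> (Suc j) \<and> 0 < \<tau> (Suc j))
    \<and> (AE t in lborel. \<sigma> j < ereal t \<and> ereal t < \<tau> (Suc j) \<longrightarrow> sgn (v t) \<noteq> 0)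
    \<and> friction_ode_solution b m fd r (\<tau> (Suc j)) (x s) x v
    \<and> (\<forall>y w. friction_ode_solution b m fd r (\<tau> (Suc j)) (x s) y w \<longrightarrow>
          (\<forall>t. r \<le> t \<and> ereal t < \<tau> (Suc j) \<longrightarrow> y t = x t \<and> w t = v t))"
proof -
  note traj = \<open>two_phase_trajectory b m fd fs x0 x v \<tau> \<sigma>\<close>
  note lip = \<open>locally_lipschitz_on (UNIV \<times> {0..}) (\<lambda>(z, t). b z t)\<close>
  note \<tau>j = \<open>\<tau> j = ereal s\<close> and \<sigma>j = \<open>\<sigma> j = ereal r\<close>
  define T where "T = \<tau> (Suc j)"
  have "s \<ge> 0" "s \<le> r"
    using two_phase_times_nonneg[OF traj, of j] by (auto simp: \<tau>j \<sigma>j)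
  then have "r \<ge> 0" by simp
  have "\<sigma> j = Inf (ereal ` {t. s \<le> t \<and> \<bar>b (x s) t\<bar> > fs})"
    using traj \<tau>j unfolding two_phase_trajectory_def by blast
  then have force_r: "\<bar>b (x s) r\<bar> \<ge> fs"
    using first_exceedance_force_ge[OF lip \<open>s \<ge> 0\<close> \<open>s \<le> r\<close>] \<sigma>j by simp
  obtain y w where vi: "vi_solution b m fd r (x s) y w"
    and T: "T = Inf (ereal ` {t. r < t \<and> w t = 0 \<and> \<bar>b (y t) t\<bar> \<le> fs})"
    and eq: "\<And>t. r \<le> t \<Longrightarrow> ereal t \<le> T \<Longrightarrow> x t = y t \<and> v t = w t"
    using two_phase_dynamic_phase[OF traj \<tau>j \<sigma>j] unfolding T_def by blast
  have "ereal r \<le> T"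
    unfolding T by (auto intro!: Inf_greatest)
  have slip: "\<bar>b (y t) t\<bar> > fd" if "r < t" "ereal t < T" "w t = 0" for t
  proof (rule ccontr)
    assume "\<not> \<bar>b (y t) t\<bar> > fd"
    then have "T \<le> ereal t"
      unfolding T using that \<open>fd \<le> fs\<close> by (intro Inf_lower) auto
    then show False
      using that by simp
  qed
  have ode: "AE t in lborel. r < t \<and> ereal t < T \<longrightarrow> w t \<noteq> 0 \<and>
      (\<exists>a. (w has_real_derivative a) (at t) \<and> m * a + sgn (w t) * fd = b (y t) t)"
    using vi \<open>m > 0\<close> slip by (rule vi_solution_AE_friction_ode)
  have "\<sigma> j < T \<and> 0 < T" if strict: "fd < fs"
  proof -
    obtain \<delta> where \<delta>: "\<delta> > 0" "\<And>t. r < t \<Longrightarrow> t \<le> r + \<delta> \<Longrightarrow> w t \<noteq> 0"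
      using vi_solution_leaves_rest[OF vi \<open>r \<ge> 0\<close> \<open>m > 0\<close> lip _ \<open>fd > 0\<close>] strict force_r
      by (metis less_le_trans)
    have "ereal (r + \<delta>) \<le> T"
      unfolding T using \<delta>(2) by (intro Inf_greatest) (force simp: not_le[symmetric])
    moreover have "ereal r < ereal (r + \<delta>)" "ereal 0 < ereal (r + \<delta>)"
      using \<delta>(1) \<open>r \<ge> 0\<close> by auto
    ultimately show ?thesis
      unfolding \<sigma>j zero_ereal_def by (meson less_le_trans)
  qed
  moreover have "AE t in lborel. \<sigma> j < ereal t \<and> ereal t < T \<longrightarrow> sgn (v t) \<noteq> 0"
    using ode
  proof eventually_elim
    case (elim t)
    show ?case
    proof
      assume "\<sigma> j < ereal t \<and> ereal t < T"
      then have t: "r < t" "ereal t < T"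
        by (auto simp: \<sigma>j)
      then show "sgn (v t) \<noteq> 0"
        using elim eq[of t] by (simp add: sgn_zero_iff)
    qed
  qed
  moreover have sol: "friction_ode_solution b m fd r T (x s) x v"
  proof (rule friction_ode_solution_from_vi[OF vi \<open>ereal r \<le> T\<close> _ eq])
    show "AE t in lborel. r < t \<and> ereal t < T \<longrightarrow>
        (\<exists>a. (w has_real_derivative a) (at t) \<and> m * a + sgn (w t) * fd = b (y t) t)"
      using ode by eventually_elim blast
  qed
  moreover have "y' t = x t \<and> w' t = v t"
    if "friction_ode_solution b m fd r T (x s) y' w'" "r \<le> t" "ereal t < T" for y' w' t
    using friction_ode_solution_unique[OF that(1) sol \<open>m > 0\<close> _ \<open>r \<ge> 0\<close> lip that(2,3)]
      \<open>fd > 0\<close> by simp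
  ultimately show ?thesis
    unfolding T_def by blast
qed

end
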